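(* For $x\in\left(0,\frac{\pi}{2}\right)$ define $L^*=L(1+\sin x,1-\sin x)$, $X^{**}=\frac{2\sin x}{L^*}$ and $k^*=\frac{X^{**}}{2x}$, where $L$ is the logarithmic mean. Then for every $x\in\left(0,\frac{\pi}{2}\right)$ one has $$\tan x+x>X^{**}>4x-2\sin x$$ and $$\left(\frac{\sin x}{x}\right)^2+\frac{\tan x}{x}>M(x)>2,$$ where $M(x)=(k^* )^2-2k^*+3$ if $k^*\le 2$ and $M(x)=2k^*-1$ if $k^*>2$.
   Context: The logarithmic mean of positive reals $a,b$ is $L(a,b)=\frac{a-b}{\ln a-\ln b}$ for $a\ne b$, and $L(a,a)=a$. *)

theory Defs
  imports Complex_Main
begin

text \<open>Only meaningful for positive \<open>a\<close> and \<open>b\<close>.\<close>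
definition log_mean :: "real \<Rightarrow> real \<Rightarrow> real" where
  "log_mean a b = (if a = b then a else (a - b) / (ln a - ln b))"

text \<open>The following functions are intended for \<open>0 < x < pi / 2\<close>, where \<open>1 + sin x\<close> and
  \<open>1 - sin x\<close> are positive. \<open>L_star\<close>, \<open>X_star2\<close>, \<open>k_star\<close> and \<open>M_fun\<close> stand for
  $L^*$, $X^{**}$, $k^*$ and $M$.\<close>

definition L_star :: "real \<Rightarrow> real" where
  "L_star x = log_mean (1 + sin x) (1 - sin x)"

definition X_star2 :: "real \<Rightarrow> real" where
  "X_star2 x = 2 * sin x / L_star x"

definition k_star :: "real \<Rightarrow> real" where
  "k_star x = X_star2 x / (2 * x)"

definition M_fun :: "real \<Rightarrow> real" where
  "M_fun x = (if k_star x \<le> 2 then (k_star x)\<^sup>2 - 2 * k_star x + 3 else 2 * k_star x - 1)"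

end

theory Submission
  imports Defs
begin

text \<open>Here \<open>X** = ln (1 + sin x) - ln (1 - sin x)\<close> vanishes at \<open>0\<close> and has derivative \<open>2 / cos x\<close>,
  so both of its bounds follow by comparing derivatives, which in each case leaves a square; since
  \<open>sin x < x\<close>, the lower one gives \<open>k* > 1\<close>. Divided by \<open>x\<close>, the bounds say \<open>tan x / x > 2 k* - 1\<close> and
  \<open>sin x / x > 2 - k*\<close>. The first settles the case \<open>k* > 2\<close>; if \<open>k* \<le> 2\<close>, add it to the
  square of the second, since \<open>(2 - k*)\<^sup>2 + 2 k* - 1 = (k*)\<^sup>2 - 2 k* + 3\<close>.\<close>

lemma abs_sin_less_one_if_cos_pos:
  fixes x :: real
  assumes "cos x > 0"
  shows "- 1 < sin x" "sin x < 1"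
proof -
  have "(sin x)\<^sup>2 < 1"
    using assms zero_less_power[OF assms, of 2] sin_cos_squared_add[of x] by linarith
  then have "\<bar>sin x\<bar> < 1"
    by (simp add: abs_square_less_1)
  then show "- 1 < sin x" "sin x < 1"
    by linarith+
qed

text \<open>The arguments \<open>1 + sin x\<close> and \<open>1 - sin x\<close> differ by
  \<open>2 * sin x\<close>, which cancels against the numerator of \<open>X_star2\<close>;
  \<open>sin x > 0\<close> rules out the branch of equal arguments.\<close>

lemma X_star2_eq:
  assumes "0 < x" "x < pi / 2"
  shows "X_star2 x = ln (1 + sin x) - ln (1 - sin x)"
proof -
  have "sin x > 0"
    using assms by (intro sin_gt_zero) auto
  then show ?thesis
    by (simp add: X_star2_def L_star_def log_mean_def)
qed

text \<open>The two logarithmic derivatives combine over the denominator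
  \<open>(1 + sin x) * (1 - sin x) = (cos x)\<^sup>2\<close>. The hypothesis
  \<open>cos x > 0\<close> also covers the point \<open>0\<close>, where the comparisons
  start.\<close>

lemma has_real_derivative_ln_sin_diff:
  fixes x :: real
  assumes "cos x > 0"
  shows "((\<lambda>x. ln (1 + sin x) - ln (1 - sin x)) has_real_derivative 2 / cos x) (at x)"
proof -
  note s = abs_sin_less_one_if_cos_pos[OF assms]
  have "cos x / (1 + sin x) + cos x / (1 - sin x) = cos x * 2 / ((1 + sin x) * (1 - sin x))"
    using s by (simp add: field_simps)
  also have "(1 + sin x) * (1 - sin x) = (cos x)\<^sup>2"
    by (simp add: cos_squared_eq algebra_simps power2_eq_square)
  also have "cos x * 2 / (cos x)\<^sup>2 = 2 / cos x"
    using assms by (simp add: power2_eq_square)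
  finally have *: "cos x / (1 + sin x) + cos x / (1 - sin x) = 2 / cos x" .
  show ?thesis
    unfolding *[symmetric] using s
    by (auto intro!: derivative_eq_intros simp: field_simps)
qed

text \<open>Positivity of \<open>f'\<close> is asked only inside the interval, since in every use
  below \<open>f'\<close> vanishes at \<open>0\<close>.\<close>

lemma DERIV_pos_imp_pos:
  fixes f f' :: "real \<Rightarrow> real"
  assumes "0 < x" "f 0 = 0"
    and "\<And>t. 0 \<le> t \<Longrightarrow> t \<le> x \<Longrightarrow> (f has_real_derivative f' t) (at t)"
    and "\<And>t. 0 < t \<Longrightarrow> t < x \<Longrightarrow> f' t > 0"
  shows "f x > 0"
proof -
  have "f 0 < f x"
  proof (rule DERIV_pos_imp_increasing_open[OF assms(1)])
    show "\<exists>y. (f has_real_derivative y) (at t) \<and> y > 0" if "0 < t" "t < x" for t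
      using assms(3)[of t] assms(4)[of t] that by auto
    show "continuous_on {0..x} f"
      using assms(3) by (intro DERIV_continuous_on) (auto intro: has_field_derivative_at_within)
  qed
  then show ?thesis
    using assms(2) by simp
qed

context
  fixes x :: real
  assumes x: "0 < x" "x < pi / 2"
begin

private lemma cos_pos: "cos t > 0" if "0 \<le> t" "t \<le> x" for t
  using that x by (intro cos_gt_zero_pi) auto

private lemma cos_less_one: "cos t < 1" if "0 < t" "t < x" for t
  using that x cos_monotone_0_pi[of 0 t] by simp

lemma X_star2_less: "X_star2 x < tan x + x"
proof -
  have "tan x + x - (ln (1 + sin x) - ln (1 - sin x)) > 0"
  proof (rule DERIV_pos_imp_pos[where f' = "\<lambda>t. inverse ((cos t)\<^sup>2) + 1 - 2 / cos t", OF x(1)])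
    fix t assume t: "0 \<le> t" "t \<le> x"
    show "((\<lambda>x. tan x + x - (ln (1 + sin x) - ln (1 - sin x))) has_real_derivative
        inverse ((cos t)\<^sup>2) + 1 - 2 / cos t) (at t)"
      using cos_pos[OF t]
      by (intro DERIV_diff DERIV_add DERIV_tan DERIV_ident has_real_derivative_ln_sin_diff) auto
  next
    fix t assume t: "0 < t" "t < x"
    have c: "cos t > 0" "cos t < 1"
      using t cos_pos cos_less_one by auto
    \<comment> \<open>In terms of \<open>u = 1 / cos t\<close> the derivative is
      \<open>u\<^sup>2 - 2 * u + 1\<close>, and \<open>u > 1\<close>.\<close>
    have "0 < (1 / cos t - 1)\<^sup>2"
      using c by simp
    also have "\<dots> = inverse ((cos t)\<^sup>2) + 1 - 2 / cos t"
      using c by (simp add: power2_eq_square field_simps)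
    finally show "inverse ((cos t)\<^sup>2) + 1 - 2 / cos t > 0" .
  qed simp
  then show ?thesis
    using X_star2_eq x by simp
qed

lemma X_star2_greater: "X_star2 x > 4 * x - 2 * sin x"
proof -
  have "ln (1 + sin x) - ln (1 - sin x) - (4 * x - 2 * sin x) > 0"
  proof (rule DERIV_pos_imp_pos[where f' = "\<lambda>t. 2 / cos t - (4 - 2 * cos t)", OF x(1)])
    fix t assume t: "0 \<le> t" "t \<le> x"
    have "((\<lambda>x. 4 * x - 2 * sin x) has_real_derivative 4 - 2 * cos t) (at t)"
      by (auto intro!: derivative_eq_intros)
    then show "((\<lambda>x. ln (1 + sin x) - ln (1 - sin x) - (4 * x - 2 * sin x)) has_real_derivative
        2 / cos t - (4 - 2 * cos t)) (at t)"
      using cos_pos[OF t] by (intro DERIV_diff[OF has_real_derivative_ln_sin_diff])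
  next
    fix t assume t: "0 < t" "t < x"
    have c: "cos t > 0" "cos t < 1"
      using t cos_pos cos_less_one by auto
    \<comment> \<open>Over the common denominator \<open>cos t\<close>, the numerator
      \<open>2 - 4 * cos t + 2 * (cos t)\<^sup>2\<close> is twice a square.\<close>
    have "0 < 2 * (1 - cos t)\<^sup>2 / cos t"
      using c by simp
    also have "\<dots> = 2 / cos t - (4 - 2 * cos t)"
      using c by (simp add: power2_eq_square field_simps)
    finally show "2 / cos t - (4 - 2 * cos t) > 0" .
  qed simp
  then show ?thesis
    using X_star2_eq x by simp
qed

lemma k_star_greater_one: "k_star x > 1"
proof -
  have "x - sin x > 0"
  proof (rule DERIV_pos_imp_pos[where f' = "\<lambda>t. 1 - cos t", OF x(1)])
    show "((\<lambda>x. x - sin x) has_real_derivative 1 - cos t) (at t)" for t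
      by (auto intro!: derivative_eq_intros)
  qed (use cos_less_one in auto)
  \<comment> \<open>The lower bound equals \<open>2 * x + 2 * (x - sin x)\<close>.\<close>
  then have "X_star2 x > 2 * x"
    using X_star2_greater by linarith
  then show ?thesis
    using x by (simp add: k_star_def field_simps)
qed

end

theorem theorem3p2:
  fixes x :: real
  assumes "0 < x" and "x < pi / 2"
  shows "tan x + x > X_star2 x \<and> X_star2 x > 4 * x - 2 * sin x \<and>
         (sin x / x)\<^sup>2 + tan x / x > M_fun x \<and> M_fun x > 2"
proof -
  define k where "k = k_star x"
  note upper = X_star2_less[OF assms] and lower = X_star2_greater[OF assms]
  have X: "X_star2 x = 2 * x * k"
    using assms by (simp add: k_def k_star_def)
  have k: "k > 1"
    using k_star_greater_one[OF assms] by (simp add: k_def)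
  have tan: "tan x / x > 2 * k - 1"
    using upper assms unfolding X by (simp add: field_simps)
  have sin: "sin x / x > 2 - k"
    using lower assms unfolding X by (simp add: field_simps)
  have "M_fun x > 2"
  proof (cases "k \<le> 2")
    case True
    \<comment> \<open>Completing the square makes \<open>k > 1\<close> give strictness; in the other
      branch \<open>2 * k - 1 > 3\<close>.\<close>
    then have "M_fun x = (k - 1)\<^sup>2 + 2"
      by (simp add: M_fun_def power2_eq_square algebra_simps flip: k_def)
    with k show ?thesis
      by simp
  qed (simp add: M_fun_def flip: k_def)
  moreover have "(sin x / x)\<^sup>2 + tan x / x > M_fun x"
  proof (cases "k \<le> 2")
    case True
    \<comment> \<open>Squaring keeps the order because \<open>2 - k\<close> is nonnegative in this
      case; the strict inequality then comes from the bound on \<open>tan x / x\<close>.\<close>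
    have "(2 - k)\<^sup>2 \<le> (sin x / x)\<^sup>2"
      using sin True by (intro power_mono) auto
    then have "(sin x / x)\<^sup>2 + tan x / x > (2 - k)\<^sup>2 + (2 * k - 1)"
      using tan by linarith
    also have "(2 - k)\<^sup>2 + (2 * k - 1) = M_fun x"
      using True by (simp add: M_fun_def power2_eq_square algebra_simps flip: k_def)
    finally show ?thesis .
  next
    case False
    then have "M_fun x = 2 * k - 1"
      by (simp add: M_fun_def flip: k_def)
    with tan show ?thesis
      using zero_le_power2[of "sin x / x"] by linarith
  qed
  ultimately show ?thesis
    using upper lower by blast
qed

end
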